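(* Let $A$ be a set of $\ell\cdot n$ points in a finite metric space, let $c:[\ell\cdot n]\rightarrow[\ell]$ be a balanced coloring of $A$, and let $k$ be an integer. There exists an $O(ndk)$-time algorithm that computes a set of $k$ points $C\subset A$ such that there exists a fair $k$-center clustering of $A$ using $C$ as centers whose cost is at most $3$ times the optimal fair $k$-center cost.
   Context: A coloring $c:[\ell n]\to[\ell]$ is balanced if each color class has exactly $n$ points; a set of points is balanced if it contains equally many points of each color. A fair $k$-center clustering assigns every point to one of at most $k$ centers such that each cluster (set of points assigned to a common center) is balanced; its cost is the maximum distance from a point to its assigned center. In the running time, $d$ denotes the dimension of the representation of the points (so that a distance evaluation costs $O(d)$).
   Formalization: The constant hidden in O(ndk) may depend on the number of colors ℓ (one algorithm serves all ℓ); with a constant independent of ℓ the claim fails, since only O(1) of the ℓn points could be inspected when n, d, k are fixed. Optimal centers are taken from A. *)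

theory Defs
  imports "HOL-Analysis.Analysis"
begin

section \<open>Fair \<open>k\<close>-center clustering\<close>

text \<open>
  The points are listed as \<open>a 0, \<dots>, a (l * n - 1)\<close>, and \<open>c i\<close> is the colour of \<open>a i\<close>.
  The index sets \<open>[l * n]\<close> and \<open>[l]\<close> are rendered 0-based.
\<close>

definition balanced_coloring :: "nat \<Rightarrow> nat \<Rightarrow> (nat \<Rightarrow> nat) \<Rightarrow> bool" where
  "balanced_coloring l n c \<longleftrightarrow>
     c \<in> {..<l * n} \<rightarrow> {..<l} \<and> (\<forall>j<l. card {i. i < l * n \<and> c i = j} = n)"

definition color_count :: "nat \<Rightarrow> (nat \<Rightarrow> 'a) \<Rightarrow> (nat \<Rightarrow> nat) \<Rightarrow> 'a set \<Rightarrow> nat \<Rightarrow> nat" where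
  "color_count N a c S j = card {i. i < N \<and> a i \<in> S \<and> c i = j}"

definition balanced_set :: "nat \<Rightarrow> nat \<Rightarrow> (nat \<Rightarrow> 'a) \<Rightarrow> (nat \<Rightarrow> nat) \<Rightarrow> 'a set \<Rightarrow> bool" where
  "balanced_set l N a c S \<longleftrightarrow>
     (\<forall>j<l. \<forall>j'<l. color_count N a c S j = color_count N a c S j')"

text \<open>
  A clustering is given by its assignment \<open>\<phi>\<close> of points to centers. A center may have an
  empty cluster, and a center need not be assigned to itself.
\<close>

definition fair_clustering ::
  "nat \<Rightarrow> nat \<Rightarrow> (nat \<Rightarrow> 'a) \<Rightarrow> (nat \<Rightarrow> nat) \<Rightarrow> 'a set \<Rightarrow> ('a \<Rightarrow> 'a) \<Rightarrow> bool" where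
  "fair_clustering l N a c C \<phi> \<longleftrightarrow>
     \<phi> \<in> a ` {..<N} \<rightarrow> C \<and>
     (\<forall>x\<in>C. balanced_set l N a c {p \<in> a ` {..<N}. \<phi> p = x})"

definition kcenter_cost :: "('a \<Rightarrow> 'a \<Rightarrow> real) \<Rightarrow> 'a set \<Rightarrow> ('a \<Rightarrow> 'a) \<Rightarrow> real" where
  "kcenter_cost dst A \<phi> = Max ((\<lambda>p. dst p (\<phi> p)) ` A)"

text \<open>
  The optimum ranges over centers chosen among the points themselves. For \<open>N > 0\<close> and \<open>k > 0\<close>
  the infimum below is that of a finite nonempty set of reals, hence a minimum, provided the
  whole point set is balanced (then a single cluster is feasible).
\<close>

definition fair_kcenter_opt ::
  "('a \<Rightarrow> 'a \<Rightarrow> real) \<Rightarrow> nat \<Rightarrow> nat \<Rightarrow> nat \<Rightarrow> (nat \<Rightarrow> 'a) \<Rightarrow> (nat \<Rightarrow> nat) \<Rightarrow> real" where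
  "fair_kcenter_opt dst k l N a c =
     Inf {kcenter_cost dst (a ` {..<N}) \<phi> | \<phi> C.
            C \<subseteq> a ` {..<N} \<and> card C \<le> k \<and> fair_clustering l N a c C \<phi>}"


section \<open>Random access machine with a distance oracle\<close>

text \<open>
  Algorithms are finite structured programs over two kinds of zero-initialised arrays, with
  natural numbers and with distances as entries; a scalar is cell 0 of an array. Points are
  accessible only by their indices, through a distance oracle.

  Every operation costs 1, except for a distance evaluation, which costs \<open>d\<close>. The only arithmetic
  is the successor, so no number ever exceeds the maximum of the input numbers and the program
  constants by more than the running time, which justifies the unit costs. Distances can be
  stored and compared but not computed with.
\<close>

type_synonym vname = string

datatype nexp = Const nat | Load vname nexp | Succ nexp

datatype dexp = DLoad vname nexp | Dist nexp nexp

datatype test = Less nexp nexp | DLess dexp dexp | Neg test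

datatype com =
    Skip
  | Store vname nexp nexp
  | DStore vname nexp dexp
  | Seq com com
  | If test com com
  | While test com

record store =
  nmem :: "vname \<Rightarrow> nat \<Rightarrow> nat"
  dmem :: "vname \<Rightarrow> nat \<Rightarrow> real"

primrec nval :: "nexp \<Rightarrow> store \<Rightarrow> nat" where
  "nval (Const m) s = m"
| "nval (Load x e) s = nmem s x (nval e s)"
| "nval (Succ e) s = Suc (nval e s)"

primrec ncost :: "nexp \<Rightarrow> nat" where
  "ncost (Const m) = 1"
| "ncost (Load x e) = 1 + ncost e"
| "ncost (Succ e) = 1 + ncost e"

primrec dval :: "(nat \<Rightarrow> nat \<Rightarrow> real) \<Rightarrow> dexp \<Rightarrow> store \<Rightarrow> real" where
  "dval D (DLoad x e) s = dmem s x (nval e s)"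
| "dval D (Dist e f) s = D (nval e s) (nval f s)"

primrec dcost :: "nat \<Rightarrow> dexp \<Rightarrow> nat" where
  "dcost d (DLoad x e) = 1 + ncost e"
| "dcost d (Dist e f) = d + ncost e + ncost f"

primrec tval :: "(nat \<Rightarrow> nat \<Rightarrow> real) \<Rightarrow> test \<Rightarrow> store \<Rightarrow> bool" where
  "tval D (Less e f) s \<longleftrightarrow> nval e s < nval f s"
| "tval D (DLess e f) s \<longleftrightarrow> dval D e s < dval D f s"
| "tval D (Neg b) s \<longleftrightarrow> \<not> tval D b s"

primrec tcost :: "nat \<Rightarrow> test \<Rightarrow> nat" where
  "tcost d (Less e f) = 1 + ncost e + ncost f"
| "tcost d (DLess e f) = 1 + dcost d e + dcost d f"
| "tcost d (Neg b) = 1 + tcost d b"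

definition nupdate :: "vname \<Rightarrow> nat \<Rightarrow> nat \<Rightarrow> store \<Rightarrow> store" where
  "nupdate x i v s = s\<lparr>nmem := (nmem s)(x := (nmem s x)(i := v))\<rparr>"

definition dupdate :: "vname \<Rightarrow> nat \<Rightarrow> real \<Rightarrow> store \<Rightarrow> store" where
  "dupdate x i v s = s\<lparr>dmem := (dmem s)(x := (dmem s x)(i := v))\<rparr>"

text \<open>
  \<open>exec D d P s t s'\<close>: with distance oracle \<open>D\<close> and evaluation cost \<open>d\<close>, the program \<open>P\<close> started
  in \<open>s\<close> terminates in \<open>s'\<close> after time \<open>t\<close>.
\<close>

inductive exec ::
  "(nat \<Rightarrow> nat \<Rightarrow> real) \<Rightarrow> nat \<Rightarrow> com \<Rightarrow> store \<Rightarrow> nat \<Rightarrow> store \<Rightarrow> bool"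
  for D :: "nat \<Rightarrow> nat \<Rightarrow> real" and d :: nat where
  Skip: "exec D d Skip s 1 s"
| Store: "exec D d (Store x e f) s (1 + ncost e + ncost f) (nupdate x (nval e s) (nval f s) s)"
| DStore: "exec D d (DStore x e f) s (1 + ncost e + dcost d f)
             (dupdate x (nval e s) (dval D f s) s)"
| Seq: "exec D d P s t s' \<Longrightarrow> exec D d Q s' u s'' \<Longrightarrow> exec D d (Seq P Q) s (t + u) s''"
| IfTrue: "tval D b s \<Longrightarrow> exec D d P s t s' \<Longrightarrow> exec D d (If b P Q) s (1 + tcost d b + t) s'"
| IfFalse: "\<not> tval D b s \<Longrightarrow> exec D d Q s t s' \<Longrightarrow> exec D d (If b P Q) s (1 + tcost d b + t) s'"
| WhileFalse: "\<not> tval D b s \<Longrightarrow> exec D d (While b P) s (1 + tcost d b) s"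
| WhileTrue: "tval D b s \<Longrightarrow> exec D d P s t s' \<Longrightarrow> exec D d (While b P) s' u s'' \<Longrightarrow>
    exec D d (While b P) s (1 + tcost d b + t + u) s''"

inductive_cases exec_SkipE: "exec D d Skip s t s'"
inductive_cases exec_StoreE: "exec D d (Store x e f) s t s'"
inductive_cases exec_DStoreE: "exec D d (DStore x e f) s t s'"
inductive_cases exec_SeqE: "exec D d (Seq P Q) s t s'"
inductive_cases exec_IfE: "exec D d (If b P Q) s t s'"
inductive_cases exec_WhileE: "exec D d (While b P) s t s'"

lemma exec_deterministic:
  "exec D d P s t s' \<Longrightarrow> exec D d P s u s'' \<Longrightarrow> t = u \<and> s' = s''"
proof (induction arbitrary: u s'' rule: exec.induct)
  case Skip
  then show ?case by (elim exec_SkipE) simp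
next
  case Store
  then show ?case by (elim exec_StoreE) simp
next
  case DStore
  then show ?case by (elim exec_DStoreE) simp
next
  case (Seq P s t s' Q t' s3)
  from Seq.prems obtain u1 u2 s1
    where "u = u1 + u2" "exec D d P s u1 s1" "exec D d Q s1 u2 s''"
    by (rule exec_SeqE)
  with Seq.IH(1)[of u1 s1] Seq.IH(2)[of u2 s''] show ?case by simp
next
  case (IfTrue b s P t s' Q)
  from IfTrue.prems IfTrue.hyps(1) obtain u1
    where "u = 1 + tcost d b + u1" "exec D d P s u1 s''"
    by (auto elim!: exec_IfE)
  with IfTrue.IH[of u1 s''] show ?case by simp
next
  case (IfFalse b s Q t s' P)
  from IfFalse.prems IfFalse.hyps(1) obtain u1
    where "u = 1 + tcost d b + u1" "exec D d Q s u1 s''"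
    by (auto elim!: exec_IfE)
  with IfFalse.IH[of u1 s''] show ?case by simp
next
  case (WhileFalse b s P)
  from WhileFalse.prems show ?case
    by (rule exec_WhileE) (use WhileFalse.hyps in simp_all)
next
  case (WhileTrue b s P t s' t' s3)
  from WhileTrue.prems obtain u1 u2 s1
    where "u = 1 + tcost d b + u1 + u2" "exec D d P s u1 s1" "exec D d (While b P) s1 u2 s''"
    by (rule exec_WhileE) (use WhileTrue.hyps(1) in simp_all)
  with WhileTrue.IH(1)[of u1 s1] WhileTrue.IH(2)[of u2 s''] show ?case by simp
qed

text \<open>The oracle reveals nothing for indices that are out of range.\<close>

definition dist_oracle :: "nat \<Rightarrow> (nat \<Rightarrow> 'a) \<Rightarrow> ('a \<Rightarrow> 'a \<Rightarrow> real) \<Rightarrow> nat \<Rightarrow> nat \<Rightarrow> real" where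
  "dist_oracle N a dst i j = (if i < N \<and> j < N then dst (a i) (a j) else 0)"

definition input_store :: "nat \<Rightarrow> nat \<Rightarrow> nat \<Rightarrow> (nat \<Rightarrow> nat) \<Rightarrow> store" where
  "input_store l N k c =
     \<lparr>nmem = (\<lambda>x i. if x = ''points'' \<and> i = 0 then N
                    else if x = ''colors'' \<and> i = 0 then l
                    else if x = ''k'' \<and> i = 0 then k
                    else if x = ''coloring'' \<and> i < N then c i
                    else 0),
      dmem = (\<lambda>x i. 0)\<rparr>"

definition output_points :: "(nat \<Rightarrow> 'a) \<Rightarrow> nat \<Rightarrow> store \<Rightarrow> 'a set" where
  "output_points a k s = (\<lambda>i. a (nmem s ''centers'' i)) ` {..<k}"

end

theory Submission
  imports Defs
begin

text \<open>
  Farthest-first traversal, blind to the colours, yields \<open>k\<close> centers within distance \<open>2r\<close> of every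
  point, where \<open>r\<close> is the optimal fair cost: otherwise \<open>k + 1\<close> points at pairwise distance more
  than \<open>2r\<close> would exist, two of which share an optimal center. Moving every optimal cluster as a
  whole to the chosen center nearest to its own center keeps the clusters balanced, as they are
  unions of balanced clusters, and costs at most \<open>r + 2r\<close>.
\<close>

section \<open>Reasoning about running times\<close>

text \<open>Total correctness with a time budget. \<open>T\<close> is only an upper bound, so
  different branches or loop iterations can share one bound.\<close>

definition run ::
  "(nat \<Rightarrow> nat \<Rightarrow> real) \<Rightarrow> nat \<Rightarrow> com \<Rightarrow> store \<Rightarrow> nat \<Rightarrow> (store \<Rightarrow> bool) \<Rightarrow> bool" where
  "run D d P s T Q \<longleftrightarrow> (\<exists>t s'. exec D d P s t s' \<and> t \<le> T \<and> Q s')"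

lemma run_mono:
  "run D d P s T Q \<Longrightarrow> T \<le> T' \<Longrightarrow> (\<And>s'. Q s' \<Longrightarrow> Q' s') \<Longrightarrow> run D d P s T' Q'"
  unfolding run_def by (meson le_trans)

lemma run_le: "run D d P s T Q \<Longrightarrow> T \<le> T' \<Longrightarrow> run D d P s T' Q"
  by (rule run_mono)

lemma run_Skip: "Q s \<Longrightarrow> run D d Skip s 1 Q"
  unfolding run_def by (blast intro: exec.Skip)

lemma run_Store:
  "Q (nupdate x (nval e s) (nval f s) s) \<Longrightarrow> run D d (Store x e f) s (1 + ncost e + ncost f) Q"
  unfolding run_def by (blast intro: exec.Store)

lemma run_DStore:
  "Q (dupdate x (nval e s) (dval D f s) s) \<Longrightarrow> run D d (DStore x e f) s (1 + ncost e + dcost d f) Q"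
  unfolding run_def by (blast intro: exec.DStore)

text \<open>The judgement about the second program serves as the postcondition of the first. A
  straight-line program can thus be processed by applying rules from left to right, without naming
  intermediate assertions.\<close>

lemma run_Seq:
  "run D d P s T (\<lambda>s'. run D d P' s' T' Q) \<Longrightarrow> run D d (Seq P P') s (T + T') Q"
  unfolding run_def by (meson exec.Seq add_mono)

text \<open>The sum of the branch budgets dominates each of them, so no maximum enters the bound.
  This is crude, but harmless up to constants.\<close>

lemma run_If:
  assumes "tval D b s \<Longrightarrow> run D d P s T Q"
    and "\<not> tval D b s \<Longrightarrow> run D d P' s T' Q"
  shows "run D d (If b P P') s (1 + tcost d b + (T + T')) Q"
proof (cases "tval D b s")
  case True
  with assms(1) obtain t s' where "exec D d P s t s'" "t \<le> T" "Q s'"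
    unfolding run_def by blast
  with True show ?thesis
    unfolding run_def by (intro exI[of _ "1 + tcost d b + t"] exI[of _ s'])
      (use exec.IfTrue in fastforce)
next
  case False
  with assms(2) obtain t s' where "exec D d P' s t s'" "t \<le> T'" "Q s'"
    unfolding run_def by blast
  with False show ?thesis
    unfolding run_def by (intro exI[of _ "1 + tcost d b + t"] exI[of _ s'])
      (use exec.IfFalse in fastforce)
qed

text \<open>The invariant is indexed by the iteration number, so it acts as its own termination
  measure: exactly \<open>n - m\<close> rounds follow, and the last summand pays for the failing
  test.\<close>

lemma run_While:
  assumes step: "\<And>m s. m < n \<Longrightarrow> I m s \<Longrightarrow> tval D b s \<and> run D d P s T (I (Suc m))"
    and stop: "\<And>s. I n s \<Longrightarrow> \<not> tval D b s"
    and "I m s" and "m \<le> n"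
  shows "run D d (While b P) s ((n - m) * (1 + tcost d b + T) + (1 + tcost d b)) (I n)"
  using \<open>m \<le> n\<close> \<open>I m s\<close>
\<comment> \<open>The induction runs downwards from \<open>n\<close>, where the loop stops, to
  \<open>m\<close>.\<close>
proof (induction m arbitrary: s rule: inc_induct)
  case base
  then show ?case
    unfolding run_def using exec.WhileFalse[OF stop[OF base]] by fastforce
next
  case (step m)
  from assms(1)[OF \<open>m < n\<close> step.prems] obtain t s'
    where b: "tval D b s" and P: "exec D d P s t s'" "t \<le> T" and "I (Suc m) s'"
    unfolding run_def by blast
  with step.IH obtain u s'' where "exec D d (While b P) s' u s''"
    and u: "u \<le> (n - Suc m) * (1 + tcost d b + T) + (1 + tcost d b)" and "I n s''"
    unfolding run_def by blast
  moreover have "n - m = Suc (n - Suc m)"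
    using \<open>m < n\<close> by simp
  ultimately show ?case
    unfolding run_def using exec.WhileTrue[OF b P(1)] P(2)
    by (intro exI[of _ "1 + tcost d b + t + u"] exI[of _ s'']) simp
qed


section \<open>Farthest-first traversal\<close>

text \<open>
  \<open>cen 0, \<dots>, cen (j - 1)\<close> are the centers chosen so far, \<open>G p\<close> is the distance of \<open>p\<close> to them
  (irrelevant for \<open>j = 0\<close>), and \<open>f\<close> is the next center.
\<close>

definition farthest_first ::
  "(nat \<Rightarrow> nat \<Rightarrow> real) \<Rightarrow> nat \<Rightarrow> nat \<Rightarrow> (nat \<Rightarrow> nat) \<Rightarrow> (nat \<Rightarrow> real) \<Rightarrow> nat \<Rightarrow> bool" where
  "farthest_first D N j cen G f \<longleftrightarrow>
     f < N \<and> cen ` {..<j} \<subseteq> {..<N} \<and> inj_on cen {..<j} \<and>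
     (0 < j \<longrightarrow> (\<forall>p<N. G p \<le> G f \<and> (\<exists>m<j. G p = D p (cen m)))) \<and>
     (\<forall>m<j. \<forall>p<N. G p \<le> D p (cen m)) \<and>
     (\<forall>m<j. \<forall>m'<j. m \<noteq> m' \<longrightarrow> G f \<le> D (cen m) (cen m'))"

text \<open>The maximal gap never increases, so separations obtained in earlier rounds survive, and
  the new center \<open>f\<close> is at least \<open>G f\<close> away from every old one.\<close>

lemma farthest_first_step:
  assumes D: "Metric_space {..<N} D" and ff: "farthest_first D N j cen G f" and "j < N"
    and G': "\<And>p. p < N \<Longrightarrow> G' p = (if j = 0 then D p f else min (G p) (D p f))"
    and f': "f' < N" "\<And>p. p < N \<Longrightarrow> G' p \<le> G' f'"
  shows "farthest_first D N (Suc j) (cen(j := f)) G' f'"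
proof -
  interpret Metric_space "{..<N}" D by fact
  have f: "f < N" and cen: "\<And>m. m < j \<Longrightarrow> cen m < N" and inj: "inj_on cen {..<j}"
    and far: "\<And>p. p < N \<Longrightarrow> 0 < j \<Longrightarrow> G p \<le> G f"
    and attained: "\<And>p. p < N \<Longrightarrow> 0 < j \<Longrightarrow> \<exists>m<j. G p = D p (cen m)"
    and gap_le: "\<And>p m. p < N \<Longrightarrow> m < j \<Longrightarrow> G p \<le> D p (cen m)"
    and sep: "\<And>m m'. m < j \<Longrightarrow> m' < j \<Longrightarrow> m \<noteq> m' \<Longrightarrow> G f \<le> D (cen m) (cen m')"
    using ff by (auto simp: farthest_first_def image_subset_iff)
  \<comment> \<open>Fewer than \<open>N\<close> centers miss some point \<open>p\<close>. Its gap is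
    positive, being attained at a different point, so the maximal gap \<open>G f\<close> is positive
    too, and \<open>f\<close> cannot be a center.\<close>
  have new: "f \<noteq> cen m" if "m < j" for m
  proof -
    have "card (cen ` {..<j}) < card {..<N}"
      using card_image_le[of "{..<j}" cen] \<open>j < N\<close> by simp
    then have "\<not> {..<N} \<subseteq> cen ` {..<j}"
      by (meson card_mono finite_imageI finite_lessThan not_less)
    then obtain p where p: "p < N" "p \<notin> cen ` {..<j}"
      by blast
    then obtain m' where m': "m' < j" "G p = D p (cen m')"
      using attained[of p] \<open>m < j\<close> by auto
    have "p \<noteq> cen m'"
      using p(2) m'(1) by blast
    then have "0 < G p"
      using m' p(1) cen[of m'] mdist_pos_less[of p "cen m'"] by simp
    also have "\<dots> \<le> G f"
      using far p(1) \<open>m < j\<close> by simp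
    also have "\<dots> \<le> D f (cen m)"
      using gap_le f \<open>m < j\<close> by simp
    finally show ?thesis
      using f by auto
  qed
  then have "f \<notin> cen ` {..<j}"
    by blast
  have decr: "G' p \<le> G p" if "p < N" "0 < j" for p
    using G' that by simp
  have "inj_on (cen(j := f)) {..<Suc j}"
    using inj \<open>f \<notin> cen ` {..<j}\<close> by (auto simp: inj_on_def less_Suc_eq image_iff)
  \<comment> \<open>The minimum is realised either by the new center, at position \<open>j\<close>,
    or by the old center that realised \<open>G p\<close>.\<close>
  moreover have "\<exists>m<Suc j. G' p = D p ((cen(j := f)) m)" if "p < N" for p
  proof (cases "j = 0 \<or> D p f \<le> G p")
    case True
    then show ?thesis
      using G'[OF that] by (intro exI[of _ j]) auto
  next
    case False
    then obtain m where "m < j" "G p = D p (cen m)"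
      using attained \<open>p < N\<close> by auto
    then show ?thesis
      using G'[OF that] False by (intro exI[of _ m]) auto
  qed
  moreover have "G' p \<le> D p ((cen(j := f)) m)" if "p < N" "m < Suc j" for p m
  proof (cases "m = j")
    case False
    then have "m < j"
      using that by simp
    then show ?thesis
      using decr[of p] gap_le[of p m] that False by simp
  qed (use G' that in simp)
  moreover have "G' f' \<le> D ((cen(j := f)) m) ((cen(j := f)) m')"
    if "m < Suc j" "m' < Suc j" "m \<noteq> m'" for m m'
  proof -
    have "0 < j"
      using that by auto
    have "G f \<le> D f (cen m)" "G f \<le> D (cen m) f" if "m < j" for m
      using gap_le[OF f that] commute[of f] by simp_all
    then have "G f \<le> D ((cen(j := f)) m) ((cen(j := f)) m')"
      using that sep by (auto simp: less_Suc_eq)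
    moreover have "G' f' \<le> G f"
      using decr[OF f'(1) \<open>0 < j\<close>] far[OF f'(1) \<open>0 < j\<close>] by simp
    ultimately show ?thesis
      by simp
  qed
  moreover have "(cen(j := f)) ` {..<Suc j} \<subseteq> {..<N}"
    using f cen by (auto simp: less_Suc_eq)
  ultimately show ?thesis
    unfolding farthest_first_def by (intro conjI impI allI f') assumption+
qed

section \<open>The traversal as a program\<close>

abbreviation scalar :: "vname \<Rightarrow> nexp" where
  "scalar x \<equiv> Load x (Const 0)"

text \<open>Testing \<open>j < 1\<close> singles out the first center. There the zero-initialised
  gaps must be overwritten, as no infinite distance is available to start the minimum from.\<close>

definition gap_step :: com where
  "gap_step =
     (let new_dist = Dist (scalar ''i'') (Load ''centers'' (scalar ''j''));
          update = DStore ''gap'' (scalar ''i'') new_dist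
      in If (Less (scalar ''j'') (Const 1)) update
           (If (DLess new_dist (DLoad ''gap'' (scalar ''i''))) update Skip))"

definition scan_step :: com where
  "scan_step =
     Seq gap_step
       (Seq (If (DLess (DLoad ''gap'' (scalar ''far'')) (DLoad ''gap'' (scalar ''i'')))
               (Store ''far'' (Const 0) (scalar ''i'')) Skip)
         (Store ''i'' (Const 0) (Succ (scalar ''i''))))"

definition center_step :: com where
  "center_step =
     Seq (Store ''centers'' (scalar ''j'') (scalar ''far''))
       (Seq (Store ''far'' (Const 0) (Const 0))
         (Seq (Store ''i'' (Const 0) (Const 0))
           (Seq (While (Less (scalar ''i'') (scalar ''points'')) scan_step)
             (Store ''j'' (Const 0) (Succ (scalar ''j''))))))"

definition gonzalez :: com where
  "gonzalez = While (Less (scalar ''j'') (scalar ''k'')) center_step"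

definition new_gap :: "(nat \<Rightarrow> nat \<Rightarrow> real) \<Rightarrow> nat \<Rightarrow> nat \<Rightarrow> (nat \<Rightarrow> real) \<Rightarrow> nat \<Rightarrow> real" where
  "new_gap D j f G p = (if j = 0 then D p f else min (G p) (D p f))"

text \<open>The truncated subtraction in the bound on \<open>far\<close> forces \<open>far = 0\<close> initially.\<close>

definition scan_inv ::
  "(nat \<Rightarrow> nat \<Rightarrow> real) \<Rightarrow> nat \<Rightarrow> nat \<Rightarrow> nat \<Rightarrow> (nat \<Rightarrow> nat) \<Rightarrow> (nat \<Rightarrow> real) \<Rightarrow> nat \<Rightarrow> store \<Rightarrow> bool"
  where
  "scan_inv D N k j cen G i s \<longleftrightarrow>
     nmem s ''points'' 0 = N \<and> nmem s ''k'' 0 = k \<and> nmem s ''j'' 0 = j \<and>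
     nmem s ''centers'' = cen \<and> nmem s ''i'' 0 = i \<and>
     dmem s ''gap'' = (\<lambda>p. if p < i then new_gap D j (cen j) G p else G p) \<and>
     nmem s ''far'' 0 \<le> i - 1 \<and>
     (\<forall>p<i. dmem s ''gap'' p \<le> dmem s ''gap'' (nmem s ''far'' 0))"

section \<open>The inner scan over all points\<close>

lemma run_gap_step:
  assumes "scan_inv D N k j cen G i s"
  shows "run D d gap_step s (100 + 3 * d)
    (\<lambda>s'. s' = s\<lparr>dmem := (dmem s)(''gap'' := (dmem s ''gap'')(i := new_gap D j (cen j) G i))\<rparr>)"
proof -
  have val: "nmem s ''i'' 0 = i" "nmem s ''j'' 0 = j" "nmem s ''centers'' j = cen j"
      "dmem s ''gap'' i = G i"
    using assms by (simp_all add: scan_inv_def)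
  \<comment> \<open>In the branch that skips, the store is unchanged. To fit the common
    postcondition, this is read as overwriting cell \<open>i\<close> with its own value.\<close>
  have "(dmem s ''gap'')(i := G i) = dmem s ''gap''"
    using val(4) by (rule fun_upd_idem)
  then have unchanged: "s\<lparr>dmem := (dmem s)(''gap'' := (dmem s ''gap'')(i := G i))\<rparr> = s"
    by simp
  show ?thesis
    unfolding gap_step_def Let_def
    \<comment> \<open>The rules compute the budget first, and only then is it compared with the
      rough bound. The term \<open>3 * d\<close> counts the three places where the distance
      occurs.\<close>
    apply (rule run_le)
     apply (rule run_If; (rule run_DStore | (rule run_If; rule run_DStore run_Skip)))
    using val unchanged by (auto simp: new_gap_def dupdate_def min_def)
qed

lemma scan_inv_Suc:
  assumes inv: "scan_inv D N k j cen G i s"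
    and s': "s' = s\<lparr>dmem := (dmem s)(''gap'' := (dmem s ''gap'')(i := new_gap D j (cen j) G i))\<rparr>"
  defines "far \<equiv> nmem s' ''far'' 0" and "gap \<equiv> dmem s' ''gap''"
  shows "gap far < gap i \<Longrightarrow>
      scan_inv D N k j cen G (Suc i) (nupdate ''i'' 0 (Suc i) (nupdate ''far'' 0 i s'))"
    and "\<not> gap far < gap i \<Longrightarrow> scan_inv D N k j cen G (Suc i) (nupdate ''i'' 0 (Suc i) s')"
proof -
  have gap: "gap = (\<lambda>p. if p < Suc i then new_gap D j (cen j) G p else G p)"
    using inv by (auto simp: s' gap_def scan_inv_def)
  have far: "far \<le> i - 1"
    using inv by (simp add: s' far_def scan_inv_def)
  have max: "gap p \<le> gap far" if "p < i" for p
  proof -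
    \<comment> \<open>As \<open>p < i\<close> excludes \<open>i = 0\<close>, the truncated bound is
      a strict one. Writing cell \<open>i\<close> therefore does not disturb the entry at
      \<open>far\<close>.\<close>
    have "far < i"
      using far that by simp
    moreover have "gap q = dmem s ''gap'' q" if "q < i" for q
      using that by (simp add: s' gap_def)
    moreover have "\<forall>p<i. dmem s ''gap'' p \<le> dmem s ''gap'' (nmem s ''far'' 0)"
      using inv unfolding scan_inv_def by blast
    moreover have "far = nmem s ''far'' 0"
      by (simp add: s' far_def)
    ultimately show ?thesis
      using that by simp
  qed
  have fields: "nmem s' ''points'' 0 = N" "nmem s' ''k'' 0 = k" "nmem s' ''j'' 0 = j"
      "nmem s' ''centers'' = cen"
    using inv by (simp_all add: s' scan_inv_def)
  show "scan_inv D N k j cen G (Suc i) (nupdate ''i'' 0 (Suc i) (nupdate ''far'' 0 i s'))" if "gap far < gap i"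
    unfolding scan_inv_def
  proof (intro conjI allI impI)
    show "dmem (nupdate ''i'' 0 (Suc i) (nupdate ''far'' 0 i s')) ''gap'' =
        (\<lambda>p. if p < Suc i then new_gap D j (cen j) G p else G p)"
      using gap by (simp add: nupdate_def gap_def)
    show "dmem (nupdate ''i'' 0 (Suc i) (nupdate ''far'' 0 i s')) ''gap'' p
        \<le> dmem (nupdate ''i'' 0 (Suc i) (nupdate ''far'' 0 i s')) ''gap''
            (nmem (nupdate ''i'' 0 (Suc i) (nupdate ''far'' 0 i s')) ''far'' 0)" if "p < Suc i" for p
      using max[of p] \<open>p < Suc i\<close> \<open>gap far < gap i\<close>
      by (cases "p = i") (auto simp: nupdate_def gap_def far_def)
  qed (use fields far in \<open>simp_all add: nupdate_def far_def\<close>)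
  show "scan_inv D N k j cen G (Suc i) (nupdate ''i'' 0 (Suc i) s')" if "\<not> gap far < gap i"
    unfolding scan_inv_def
  proof (intro conjI allI impI)
    show "dmem (nupdate ''i'' 0 (Suc i) s') ''gap'' =
        (\<lambda>p. if p < Suc i then new_gap D j (cen j) G p else G p)"
      using gap by (simp add: nupdate_def gap_def)
    show "dmem (nupdate ''i'' 0 (Suc i) s') ''gap'' p
        \<le> dmem (nupdate ''i'' 0 (Suc i) s') ''gap''
            (nmem (nupdate ''i'' 0 (Suc i) s') ''far'' 0)" if "p < Suc i" for p
      using max[of p] \<open>p < Suc i\<close> \<open>\<not> gap far < gap i\<close>
      by (cases "p = i") (auto simp: nupdate_def gap_def far_def)
  qed (use fields far in \<open>simp_all add: nupdate_def far_def\<close>)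
qed

lemma run_scan_step:
  assumes inv: "scan_inv D N k j cen G i s"
  shows "run D d scan_step s (200 + 3 * d) (scan_inv D N k j cen G (Suc i))"
  unfolding scan_step_def
proof (rule run_le[OF run_Seq[OF run_mono[OF run_gap_step[OF inv] order_refl]]])
  fix s'
  assume s': "s' = s\<lparr>dmem := (dmem s)(''gap'' := (dmem s ''gap'')(i := new_gap D j (cen j) G i))\<rparr>"
  have i: "nmem s' ''i'' 0 = i"
    using inv by (simp add: s' scan_inv_def)
  show "run D d
     (Seq (If (DLess (DLoad ''gap'' (scalar ''far'')) (DLoad ''gap'' (scalar ''i'')))
             (Store ''far'' (Const 0) (scalar ''i'')) Skip)
       (Store ''i'' (Const 0) (Succ (scalar ''i'')))) s' 100 (scan_inv D N k j cen G (Suc i))"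
    apply (rule run_le)
     apply (rule run_Seq, rule run_If; (rule run_Store run_Skip; rule run_Store))
    using scan_inv_Suc[OF inv s'] by (simp_all add: i nupdate_def)
qed simp

section \<open>The outer loop over the centers\<close>

definition center_inv :: "(nat \<Rightarrow> nat \<Rightarrow> real) \<Rightarrow> nat \<Rightarrow> nat \<Rightarrow> nat \<Rightarrow> store \<Rightarrow> bool" where
  "center_inv D N k j s \<longleftrightarrow>
     nmem s ''points'' 0 = N \<and> nmem s ''k'' 0 = k \<and> nmem s ''j'' 0 = j \<and>
     farthest_first D N j (nmem s ''centers'') (dmem s ''gap'') (nmem s ''far'' 0)"

lemma center_inv_after_scan:
  assumes D: "Metric_space {..<N} D" and ff: "farthest_first D N j cen G f" and "j < N"
    and scan: "scan_inv D N k j (cen(j := f)) G N s"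
  shows "center_inv D N k (Suc j) (nupdate ''j'' 0 (Suc j) s)"
proof -
  \<comment> \<open>The bound \<open>far \<le> N - 1\<close> is strict enough because
    \<open>j < N\<close> makes \<open>N\<close> positive.\<close>
  have "nmem s ''far'' 0 < N"
    using scan \<open>j < N\<close> by (auto simp: scan_inv_def)
  then have "farthest_first D N (Suc j) (cen(j := f)) (dmem s ''gap'') (nmem s ''far'' 0)"
  proof (rule farthest_first_step[OF D ff \<open>j < N\<close>, rotated])
    show "dmem s ''gap'' p \<le> dmem s ''gap'' (nmem s ''far'' 0)" if "p < N" for p
      using scan that unfolding scan_inv_def by blast
  qed (use scan in \<open>simp add: scan_inv_def new_gap_def\<close>)
  then show ?thesis
    using scan by (simp add: center_inv_def scan_inv_def nupdate_def)
qed

lemma run_center_step: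
  assumes D: "Metric_space {..<N} D" and "j < N" and inv: "center_inv D N k j s"
  shows "run D d center_step s (N * (206 + 3 * d) + 100) (center_inv D N k (Suc j))"
proof -
  \<comment> \<open>These freeze the values before the scan. The invariant \<open>scan_inv\<close>
    describes the changing \<open>gap\<close> array relative to the fixed \<open>G\<close>.\<close>
  define cen G f where "cen = nmem s ''centers''" and "G = dmem s ''gap''" and "f = nmem s ''far'' 0"
  have ff: "farthest_first D N j cen G f"
    using inv by (simp add: center_inv_def cen_def G_def f_def)
  have start: "scan_inv D N k j (cen(j := f)) G 0
      (nupdate ''i'' 0 0 (nupdate ''far'' 0 0 (nupdate ''centers'' j f s)))"
    using inv by (simp add: scan_inv_def center_inv_def nupdate_def cen_def G_def f_def)
  \<comment> \<open>Evaluating the loop test costs 6 in all. So each round costs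
    \<open>206 + 3 * d\<close>, and the final failing test adds another 6.\<close>
  have loop: "run D d (While (Less (scalar ''i'') (scalar ''points'')) scan_step) s'
      (N * (206 + 3 * d) + 6) (scan_inv D N k j (cen(j := f)) G N)"
    if "scan_inv D N k j (cen(j := f)) G 0 s'" for s'
  proof (rule run_le)
    show "run D d (While (Less (scalar ''i'') (scalar ''points'')) scan_step) s'
        ((N - 0) * (1 + tcost d (Less (scalar ''i'') (scalar ''points'')) + (200 + 3 * d)) +
         (1 + tcost d (Less (scalar ''i'') (scalar ''points''))))
        (scan_inv D N k j (cen(j := f)) G N)"
    proof (rule run_While[where I = "scan_inv D N k j (cen(j := f)) G" and m = 0])
      show "tval D (Less (scalar ''i'') (scalar ''points'')) s'' \<and>
          run D d scan_step s'' (200 + 3 * d) (scan_inv D N k j (cen(j := f)) G (Suc i))"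
        if "i < N" "scan_inv D N k j (cen(j := f)) G i s''" for i s''
      proof
        show "tval D (Less (scalar ''i'') (scalar ''points'')) s''"
          using that by (simp add: scan_inv_def)
      qed (rule run_scan_step[OF that(2)])
    qed (use that in \<open>simp_all add: scan_inv_def\<close>)
  qed simp
  have finish: "center_inv D N k (Suc j) (nupdate ''j'' 0 (Suc (nmem s' ''j'' 0)) s')"
    if "scan_inv D N k j (cen(j := f)) G N s'" for s'
    using center_inv_after_scan[OF D ff \<open>j < N\<close> that] that by (simp add: scan_inv_def)
  have "nmem s ''j'' 0 = j"
    using inv by (simp add: center_inv_def)
  show ?thesis
    unfolding center_step_def
    apply (rule run_le)
     apply ((rule run_Seq, rule run_Store)+, rule run_Seq, rule run_mono[OF loop order_refl])
    using start \<open>nmem s ''j'' 0 = j\<close> apply (simp add: nupdate_def f_def)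
     apply (rule run_Store, simp add: finish)
    apply simp
    done
qed

text \<open>There are \<open>k\<close> rounds of cost linear in \<open>l * n * d\<close>. The factor
  \<open>l\<close> goes into the constant, which depends on nothing else.\<close>

lemma run_gonzalez:
  assumes D: "Metric_space {..<l * n} (D :: nat \<Rightarrow> nat \<Rightarrow> real)" and "1 \<le> k" "k \<le> l * n" "1 \<le> d"
  shows "run D d gonzalez (input_store l (l * n) k c) (400 * Suc l * (n * d * k))
    (center_inv D (l * n) k k)"
proof (rule run_le)
  have "0 < l * n"
    using assms(2,3) by linarith
  show "run D d gonzalez (input_store l (l * n) k c)
      ((k - 0) * (1 + tcost d (Less (scalar ''j'') (scalar ''k'')) + (l * n * (206 + 3 * d) + 100)) +
       (1 + tcost d (Less (scalar ''j'') (scalar ''k''))))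
      (center_inv D (l * n) k k)"
    unfolding gonzalez_def
  proof (rule run_While[where I = "center_inv D (l * n) k" and m = 0])
    \<comment> \<open>Without any center the traversal predicate only asks for
      \<open>far < l * n\<close>. The zero-initialised store satisfies it, so the first center is
      point 0.\<close>
    show "center_inv D (l * n) k 0 (input_store l (l * n) k c)"
      using \<open>0 < l * n\<close> by (simp add: center_inv_def input_store_def farthest_first_def)
    show "tval D (Less (scalar ''j'') (scalar ''k'')) s \<and>
        run D d center_step s (l * n * (206 + 3 * d) + 100) (center_inv D (l * n) k (Suc j))"
      if "j < k" "center_inv D (l * n) k j s" for j s
    proof
      show "tval D (Less (scalar ''j'') (scalar ''k'')) s"
        using that by (simp add: center_inv_def)
      show "run D d center_step s (l * n * (206 + 3 * d) + 100) (center_inv D (l * n) k (Suc j))"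
        using that assms(3) by (intro run_center_step[OF D]) simp_all
    qed
  qed (simp_all add: center_inv_def)
  have "1 \<le> n"
    using \<open>0 < l * n\<close> by (cases "n = 0") simp_all
  have "206 + 3 * d \<le> 209 * d"
    using \<open>1 \<le> d\<close> by simp
  then have "l * n * (206 + 3 * d) \<le> l * n * (209 * d)"
    by (rule mult_le_mono2)
  moreover have "1 \<le> n * d"
    using \<open>1 \<le> n\<close> \<open>1 \<le> d\<close> by simp
  \<comment> \<open>The number 112 consists of the 100 of a round, 6 for its loop test, and 6 for
    the final test, charged to the rounds because \<open>1 \<le> k\<close>. It is absorbed using
    \<open>1 \<le> n * d\<close>.\<close>
  ultimately have "l * n * (206 + 3 * d) + 112 \<le> l * n * (209 * d) + 112 * (n * d)"
    by linarith
  also have "\<dots> \<le> 400 * Suc l * (n * d)"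
    by (simp add: algebra_simps)
  finally have "l * n * (206 + 3 * d) + 112 \<le> 400 * Suc l * (n * d)" .
  then have "k * (l * n * (206 + 3 * d) + 112) \<le> k * (400 * Suc l * (n * d))"
    by (rule mult_le_mono2)
  moreover have "(k - 0) * (1 + tcost d (Less (scalar ''j'') (scalar ''k'')) + (l * n * (206 + 3 * d) + 100)) +
      (1 + tcost d (Less (scalar ''j'') (scalar ''k''))) \<le> k * (l * n * (206 + 3 * d) + 112)"
    using \<open>1 \<le> k\<close> by (simp add: distrib_left)
  ultimately show "(k - 0) * (1 + tcost d (Less (scalar ''j'') (scalar ''k'')) + (l * n * (206 + 3 * d) + 100)) +
      (1 + tcost d (Less (scalar ''j'') (scalar ''k''))) \<le> 400 * Suc l * (n * d * k)"
    by (simp only: ac_simps)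
qed


section \<open>Fair clusterings\<close>

text \<open>A cluster of \<open>g \<circ> \<phi>\<close> is the disjoint union of the clusters of
  \<open>\<phi>\<close> whose centers \<open>g\<close> sends to the same place. Colour counts add
  over this union, and balance passes to the sums.\<close>

lemma fair_clustering_coarsen:
  assumes fair: "fair_clustering l N a c C \<phi>" and "finite C" and g: "g ` C \<subseteq> C'"
  shows "fair_clustering l N a c C' (g \<circ> \<phi>)"
  unfolding fair_clustering_def
proof
  have \<phi>: "\<phi> p \<in> C" if "p \<in> a ` {..<N}" for p
    using fair that by (auto simp: fair_clustering_def)
  then show "g \<circ> \<phi> \<in> a ` {..<N} \<rightarrow> C'"
    using g by fastforce
  show "\<forall>x\<in>C'. balanced_set l N a c {p \<in> a ` {..<N}. (g \<circ> \<phi>) p = x}"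
  proof
    fix x
    have sum: "color_count N a c {p \<in> a ` {..<N}. (g \<circ> \<phi>) p = x} j =
        (\<Sum>y\<in>{y \<in> C. g y = x}. color_count N a c {p \<in> a ` {..<N}. \<phi> p = y} j)" for j
    proof -
      have "{i. i < N \<and> a i \<in> {p \<in> a ` {..<N}. (g \<circ> \<phi>) p = x} \<and> c i = j} =
          (\<Union>y\<in>{y \<in> C. g y = x}. {i. i < N \<and> a i \<in> {p \<in> a ` {..<N}. \<phi> p = y} \<and> c i = j})"
        using \<phi> by auto
      then show ?thesis
        unfolding color_count_def using \<open>finite C\<close> by (simp add: card_UN_disjoint disjoint_iff)
    qed
    have same: "color_count N a c {p \<in> a ` {..<N}. \<phi> p = y} j =
        color_count N a c {p \<in> a ` {..<N}. \<phi> p = y} j'" if "y \<in> C" "j < l" "j' < l" for y j j'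
      using fair that unfolding fair_clustering_def balanced_set_def by blast
    show "balanced_set l N a c {p \<in> a ` {..<N}. (g \<circ> \<phi>) p = x}"
      unfolding balanced_set_def sum by (intro allI impI sum.cong refl same) simp_all
  qed
qed

text \<open>Assignments are arbitrary outside the point set, so there may be infinitely many. Their
  costs, however, all lie among the finitely many pairwise distances, which turns the infimum into a
  minimum.\<close>

lemma fair_kcenter_opt_attained:
  assumes "0 < N" "0 < k" and bal: "balanced_set l N a c (a ` {..<N})"
  obtains \<phi> C where "C \<subseteq> a ` {..<N}" "card C \<le> k" "fair_clustering l N a c C \<phi>"
    "fair_kcenter_opt dst k l N a c = kcenter_cost dst (a ` {..<N}) \<phi>"
proof -
  let ?A = "a ` {..<N}"
  let ?costs = "{kcenter_cost dst ?A \<phi> | \<phi> C.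
    C \<subseteq> ?A \<and> card C \<le> k \<and> fair_clustering l N a c C \<phi>}"
  have A: "finite ?A" "?A \<noteq> {}"
    using \<open>0 < N\<close> by auto
  have "kcenter_cost dst ?A \<phi> \<in> (\<lambda>(p, q). dst p q) ` (?A \<times> ?A)"
    if "C \<subseteq> ?A" "fair_clustering l N a c C \<phi>" for \<phi> C
  proof -
    have "kcenter_cost dst ?A \<phi> \<in> (\<lambda>p. dst p (\<phi> p)) ` ?A"
      unfolding kcenter_cost_def using A by (intro Max_in) auto
    moreover have "\<phi> p \<in> ?A" if "p \<in> ?A" for p
      using \<open>C \<subseteq> ?A\<close> \<open>fair_clustering l N a c C \<phi>\<close> that by (auto simp: fair_clustering_def)
    ultimately show ?thesis
      by force
  qed
  then have "?costs \<subseteq> (\<lambda>(p, q). dst p q) ` (?A \<times> ?A)"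
    by blast
  then have "finite ?costs"
    by (rule finite_subset) simp
  \<comment> \<open>One cluster centered at the first point shows that the set of costs is
    nonempty.\<close>
  moreover have "fair_clustering l N a c {a 0} (\<lambda>_. a 0)"
    using bal by (simp add: fair_clustering_def)
  then have "kcenter_cost dst ?A (\<lambda>_. a 0) \<in> ?costs"
    using assms(1,2) by (force intro!: exI[of _ "{a 0}"])
  ultimately have "Inf ?costs \<in> ?costs"
    by (metis (no_types, lifting) Min_in cInf_eq_Min empty_iff)
  then show thesis
    using that unfolding fair_kcenter_opt_def by blast
qed

lemma balanced_coloring_imp_balanced_set:
  assumes "balanced_coloring l n c"
  shows "balanced_set l (l * n) a c (a ` {..<l * n})"
proof -
  have "{i. i < l * n \<and> a i \<in> a ` {..<l * n} \<and> c i = j} = {i. i < l * n \<and> c i = j}" for j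
    by auto
  then show ?thesis
    using assms by (simp add: balanced_set_def color_count_def balanced_coloring_def)
qed

section \<open>The approximation guarantee\<close>

lemma Metric_space_dist_oracle:
  assumes "Metric_space M dst" "inj_on a {..<N}" "a ` {..<N} \<subseteq> M"
  shows "Metric_space {..<N} (dist_oracle N a dst)"
proof -
  interpret Metric_space M dst by fact
  have M: "a i \<in> M" if "i < N" for i
    using assms(3) that by auto
  \<comment> \<open>Injectivity of \<open>a\<close> turns distance zero between points into equality
    of their indices.\<close>
  show ?thesis
    using M assms(2)
    by unfold_locales (auto simp: dist_oracle_def commute inj_on_eq_iff triangle)
qed

text \<open>The chosen centers together with \<open>f\<close> form a family of \<open>k + 1\<close>
  points with pairwise distances at least \<open>G f\<close>. Two of them share a center of
  \<open>\<phi>\<close>, so \<open>G f \<le> 2 * r\<close>, and \<open>G f\<close> bounds the gap of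
  every point.\<close>

lemma farthest_first_covers:
  assumes "Metric_space M dst" "a ` {..<N} \<subseteq> M" "0 < k"
    and ff: "farthest_first (dist_oracle N a dst) N k cen G f"
    and C: "C \<subseteq> a ` {..<N}" "card C \<le> k"
    and \<phi>: "\<And>p. p \<in> a ` {..<N} \<Longrightarrow> \<phi> p \<in> C \<and> dst p (\<phi> p) \<le> r"
    and p: "p \<in> a ` {..<N}"
  obtains m where "m < k" "dst p (a (cen m)) \<le> 2 * r"
proof -
  interpret Metric_space M dst by fact
  have f: "f < N" and cen: "\<And>m. m < k \<Longrightarrow> cen m < N"
    using ff by (auto simp: farthest_first_def image_subset_iff)
  define h where "h = cen(k := f)"
  have h: "h m < N" if "m \<le> k" for m
    using that f cen by (auto simp: h_def)
  have sep: "G f \<le> dst (a (h m)) (a (h m'))" if "m \<le> k" "m' \<le> k" "m \<noteq> m'" for m m'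
  proof -
    have far: "G f \<le> dst (a f) (a (cen i))" if "i < k" for i
      using ff f cen[OF that] that by (auto simp: farthest_first_def dist_oracle_def)
    have "G f \<le> dst (a (cen i)) (a (cen i'))" if "i < k" "i' < k" "i \<noteq> i'" for i i'
      using ff cen that unfolding farthest_first_def dist_oracle_def by (auto split: if_splits)
    then show ?thesis
      using that far[of m] far[of m'] commute[of "a f"]
      by (cases "m = k"; cases "m' = k") (auto simp: h_def)
  qed
  \<comment> \<open>The pigeonhole principle is applied to the \<open>k + 1\<close> indices rather
    than to points: \<open>h\<close> may repeat a point when \<open>f\<close> already is a center,
    in which case \<open>G f \<le> 0\<close>.\<close>
  have "\<not> inj_on (\<lambda>m. \<phi> (a (h m))) {..k}"
  proof
    assume "inj_on (\<lambda>m. \<phi> (a (h m))) {..k}"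
    moreover have "(\<lambda>m. \<phi> (a (h m))) ` {..k} \<subseteq> C"
      using \<phi> h by auto
    ultimately have "card {..k} \<le> card C"
      using C(1) by (meson card_inj_on_le finite_imageI finite_lessThan finite_subset)
    then show False
      using C(2) by simp
  qed
  then obtain m m' where m: "m \<le> k" "m' \<le> k" "m \<noteq> m'" "\<phi> (a (h m)) = \<phi> (a (h m'))"
    by (auto simp: inj_on_def)
  have "dst (a (h m)) (a (h m')) \<le>
      dst (a (h m)) (\<phi> (a (h m))) + dst (a (h m')) (\<phi> (a (h m')))"
  proof -
    have "a (h m) \<in> M" "a (h m') \<in> M" "\<phi> (a (h m)) \<in> M"
      using h[OF m(1)] h[OF m(2)] assms(2) C(1) \<phi> by blast+
    then show ?thesis
      using triangle[of "a (h m)" "\<phi> (a (h m))" "a (h m')"] commute m(4) by metis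
  qed
  also have "\<dots> \<le> 2 * r"
    using \<phi>[of "a (h m)"] \<phi>[of "a (h m')"] h m(1,2) by force
  finally have "G f \<le> 2 * r"
    using sep[OF m(1-3)] by simp
  obtain i where i: "i < N" "p = a i"
    using p by auto
  then obtain m where "m < k" "G i = dist_oracle N a dst i (cen m)" "G i \<le> G f"
    using ff \<open>0 < k\<close> unfolding farthest_first_def by blast
  then show thesis
    using that[of m] i cen[of m] \<open>G f \<le> 2 * r\<close> by (simp add: dist_oracle_def)
qed

theorem theorem4:
  shows "\<exists>P :: com. \<forall>l :: nat. \<exists>K :: nat.
    \<forall>(n :: nat) (d :: nat) (k :: nat) (M :: 'a set) (dst :: 'a \<Rightarrow> 'a \<Rightarrow> real)
      (a :: nat \<Rightarrow> 'a) (c :: nat \<Rightarrow> nat).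
      finite M \<and> Metric_space M dst \<and>
      inj_on a {..<l * n} \<and> a ` {..<l * n} \<subseteq> M \<and>
      balanced_coloring l n c \<and>
      1 \<le> k \<and> k \<le> l * n \<and> 1 \<le> d \<longrightarrow>
      (\<exists>t s. exec (dist_oracle (l * n) a dst) d P (input_store l (l * n) k c) t s \<and>
         t \<le> K * (n * d * k) \<and>
         output_points a k s \<subseteq> a ` {..<l * n} \<and>
         card (output_points a k s) = k \<and>
         (\<exists>\<phi>. fair_clustering l (l * n) a c (output_points a k s) \<phi> \<and>
              kcenter_cost dst (a ` {..<l * n}) \<phi>
                \<le> 3 * fair_kcenter_opt dst k l (l * n) a c))"
proof (rule exI[of _ gonzalez], rule allI, rule exI[of _ "400 * Suc l" for l], intro allI impI,
    elim conjE)
  fix l n d k :: nat and M :: "'a set" and dst :: "'a \<Rightarrow> 'a \<Rightarrow> real" and a :: "nat \<Rightarrow> 'a"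
    and c :: "nat \<Rightarrow> nat"
  assume M: "Metric_space M dst" "inj_on a {..<l * n}" "a ` {..<l * n} \<subseteq> M"
    and bal: "balanced_coloring l n c" and k: "1 \<le> k" "k \<le> l * n" and "1 \<le> d"
  interpret Metric_space M dst by fact
  let ?N = "l * n" and ?A = "a ` {..<l * n}" and ?D = "dist_oracle (l * n) a dst"
  obtain t s where exec: "exec ?D d gonzalez (input_store l ?N k c) t s"
    and t: "t \<le> 400 * Suc l * (n * d * k)" and s: "center_inv ?D ?N k k s"
    using run_gonzalez[OF Metric_space_dist_oracle[OF M] k \<open>1 \<le> d\<close>] unfolding run_def by blast
  define cen where "cen = nmem s ''centers''"
  define out where "out = output_points a k s"
  have out: "out = (a \<circ> cen) ` {..<k}"
    by (simp add: out_def output_points_def cen_def comp_def)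
  obtain G f where ff: "farthest_first ?D ?N k cen G f"
    using s by (auto simp: center_inv_def cen_def)
  then have cen: "cen ` {..<k} \<subseteq> {..<?N}" "inj_on cen {..<k}"
    by (simp_all add: farthest_first_def)
  have "out \<subseteq> ?A"
    using cen(1) by (auto simp: out)
  \<comment> \<open>Distinct indices give distinct points because \<open>a\<close> is
    injective.\<close>
  have "card out = k"
    unfolding out using card_image[OF comp_inj_on[OF cen(2) inj_on_subset[OF M(2) cen(1)]]] by simp
  have "0 < ?N" "0 < k"
    using k by linarith+
  obtain \<phi> C where C: "C \<subseteq> ?A" "card C \<le> k" and fair: "fair_clustering l ?N a c C \<phi>"
    and opt: "fair_kcenter_opt dst k l ?N a c = kcenter_cost dst ?A \<phi>"
    by (rule fair_kcenter_opt_attained[where dst = dst, OF \<open>0 < ?N\<close> \<open>0 < k\<close>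
          balanced_coloring_imp_balanced_set[OF bal]])
  define r where "r = kcenter_cost dst ?A \<phi>"
  have \<phi>: "\<phi> p \<in> C \<and> dst p (\<phi> p) \<le> r" if "p \<in> ?A" for p
  proof
    show "\<phi> p \<in> C"
      using fair that unfolding fair_clustering_def by blast
    show "dst p (\<phi> p) \<le> r"
      unfolding r_def kcenter_cost_def using that by (intro Max_ge) auto
  qed
  \<comment> \<open>Optimal centers are input points themselves, so the covering bound applies to
    them.\<close>
  have "\<exists>q\<in>out. dst x q \<le> 2 * r" if "x \<in> C" for x
  proof -
    have "x \<in> ?A"
      using that C(1) by blast
    then obtain m where "m < k" "dst x (a (cen m)) \<le> 2 * r"
      using farthest_first_covers[OF M(1,3) \<open>0 < k\<close> ff C \<phi>] by metis
    then show ?thesis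
      by (auto simp: out)
  qed
  then have "\<forall>x\<in>C. \<exists>q. q \<in> out \<and> dst x q \<le> 2 * r"
    by blast
  \<comment> \<open>Any choice within \<open>2 * r\<close> will do; it need not be the nearest
    one.\<close>
  then obtain g where "\<forall>x\<in>C. g x \<in> out \<and> dst x (g x) \<le> 2 * r"
    by (rule bchoice[elim_format]) blast
  then have g: "g x \<in> out" "dst x (g x) \<le> 2 * r" if "x \<in> C" for x
    using that by blast+
  have "finite C"
    using C(1) finite_subset by blast
  then have g_fair: "fair_clustering l ?N a c out (g \<circ> \<phi>)"
    using g by (intro fair_clustering_coarsen[OF fair]) auto
  \<comment> \<open>The detour through the optimal center costs \<open>r\<close> to reach it and
    \<open>2 * r\<close> from there.\<close>
  have "dst p (g (\<phi> p)) \<le> 3 * r" if "p \<in> ?A" for p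
  proof -
    have "p \<in> M" "\<phi> p \<in> M" "g (\<phi> p) \<in> M"
      using that \<phi>[OF that] g(1)[of "\<phi> p"] C(1) \<open>out \<subseteq> ?A\<close> M(3) by blast+
    then have "dst p (g (\<phi> p)) \<le> dst p (\<phi> p) + dst (\<phi> p) (g (\<phi> p))"
      by (rule triangle)
    then show ?thesis
      using \<phi>[OF that] g(2)[of "\<phi> p"] by linarith
  qed
  moreover have "?A \<noteq> {}"
    using \<open>0 < ?N\<close> by blast
  ultimately have "kcenter_cost dst ?A (g \<circ> \<phi>) \<le> 3 * r"
    unfolding kcenter_cost_def by (subst Max_le_iff) auto
  then show "\<exists>t s. exec ?D d gonzalez (input_store l ?N k c) t s \<and>
      t \<le> 400 * Suc l * (n * d * k) \<and> output_points a k s \<subseteq> ?A \<and>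
      card (output_points a k s) = k \<and>
      (\<exists>\<phi>. fair_clustering l ?N a c (output_points a k s) \<phi> \<and>
        kcenter_cost dst ?A \<phi> \<le> 3 * fair_kcenter_opt dst k l ?N a c)"
    using exec t g_fair \<open>out \<subseteq> ?A\<close> \<open>card out = k\<close> unfolding opt r_def out_def
    by (intro exI conjI)
qed

end
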